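(* Let $T:X\to X$ be a map on a set with $f_n=f_n(T)$ finite for all $n\ge1$, and let $f^*_n=f^*_n(T)$. (1) If $\frac1n\log f^*_n\to C\in[0,\infty]$ as $n\to\infty$, then $\frac1n\log f_n\to C$ also. (2) For $C\in(0,\infty)$, $\frac1n\log f^*_n\to C$ if and only if $\frac1n\log f_n\to C$. (3) If $\frac1n\log f_n\to\infty$, then $\left\{\frac1n\log f^*_n\right\}$ may be unbounded with infinitely many limit points; that is, there exist a set $X$ and a map $T:X\to X$ with $f_n(T)$ finite for all $n\ge1$ such that $\frac1n\log f_n(T)\to\infty$ as $n\to\infty$, while the sequence $\left(\frac1n\log f^*_n(T)\right)_{n\ge1}$ is unbounded and has infinitely many limit points.
   Context: For a map $T:X\to X$ on a set $X$ and $n\ge1$, $f_n(T)=\#\{x\in X\mid T^nx=x\}$ is the number of points with period $n$, and $f^*_n(T)$ is the number of points with least period $n$, i.e. the number of $x\in X$ with $T^nx=x$ whose orbit under $T$ has exactly $n$ elements. The convention $\log 0=-\infty$ is used. A limit point of a sequence is a real number that is the limit of some subsequence. *)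

theory Defs
  imports "HOL-Analysis.Analysis"
begin

definition period_points :: "'a set \<Rightarrow> ('a \<Rightarrow> 'a) \<Rightarrow> nat \<Rightarrow> 'a set" where
  "period_points X T n = {x \<in> X. (T ^^ n) x = x}"

definition least_period_points :: "'a set \<Rightarrow> ('a \<Rightarrow> 'a) \<Rightarrow> nat \<Rightarrow> 'a set" where
  "least_period_points X T n =
     {x \<in> X. (T ^^ n) x = x \<and> card {(T ^^ k) x | k. True} = n}"

definition num_period :: "'a set \<Rightarrow> ('a \<Rightarrow> 'a) \<Rightarrow> nat \<Rightarrow> nat" where
  "num_period X T n = card (period_points X T n)"

definition num_least_period :: "'a set \<Rightarrow> ('a \<Rightarrow> 'a) \<Rightarrow> nat \<Rightarrow> nat" where
  "num_least_period X T n = card (least_period_points X T n)"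

(* A self-map of X all of whose sets of n-periodic points are finite. The finiteness matters:
   card is 0 on infinite sets. Outside X the values of T are irrelevant. *)
definition finite_period_map :: "'a set \<Rightarrow> ('a \<Rightarrow> 'a) \<Rightarrow> bool" where
  "finite_period_map X T \<longleftrightarrow>
     T \<in> X \<rightarrow> X \<and> (\<forall>n\<ge>1. finite (period_points X T n))"

(* Natural logarithm with the convention log 0 = -\<infinity>; the library's ln has ln 0 = 0. *)
definition log_ext :: "nat \<Rightarrow> ereal" where
  "log_ext m = (if m = 0 then -\<infinity> else ereal (ln (real m)))"

(* The sequence (1/n) log a(n); only the indices n \<ge> 1 are meaningful. *)
definition growth :: "(nat \<Rightarrow> nat) \<Rightarrow> nat \<Rightarrow> ereal" where
  "growth a n = ereal (1 / real n) * log_ext (a n)"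

definition limit_points :: "(nat \<Rightarrow> ereal) \<Rightarrow> real set" where
  "limit_points s =
     {l. \<exists>r. strict_mono r \<and> (\<forall>k. r k \<ge> 1) \<and> (\<lambda>k. s (r k)) \<longlonglongrightarrow> ereal l}"

(* Unbounded above. Values -\<infinity>, which come only from log 0, are deliberately not
   enough to make a sequence unbounded. *)
definition unbounded_seq :: "(nat \<Rightarrow> ereal) \<Rightarrow> bool" where
  "unbounded_seq s \<longleftrightarrow> (\<forall>M::real. \<exists>n\<ge>1. s n > ereal M)"

end

theory Submission
  imports Defs "HOL-Library.Nat_Bijection"
begin

text \<open>
  A point with period \<open>n\<close> has a least period dividing \<open>n\<close>, so, writing \<open>f\<close> and \<open>f*\<close> for the
  two counting functions,
  \[ f^*_n \le f_n \le f^*_n + \sum_{d \mid n,\, d < n} f^*_d . \]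
  Everything rests on this inequality. The sum has at most \<open>n\<close> terms, which does not matter on
  an exponential scale: if \<open>f*\<close> grows at rate \<open>C\<close> with \<open>0 \<le> C < \<infinity>\<close> then every term
  is at most about \<open>exp (C n)\<close>, so \<open>f\<close> cannot grow faster than \<open>f*\<close>; for \<open>C = \<infinity>\<close> already \<open>f* \<le> f\<close>
  suffices. Conversely, if \<open>f\<close> grows at
  rate \<open>C\<close> with \<open>0 < C < \<infinity>\<close>, then, since a proper divisor of \<open>n\<close> is at most \<open>n div 2\<close>, the
  terms with \<open>d < n\<close> contribute at most about \<open>exp (C n / 2)\<close>, which is negligible, and \<open>f*\<close> has to
  account for the growth alone. The lemmas \<open>growth_tendsto_of_le_sum\<close> and
  \<open>growth_tendsto_of_ge_minus_sum\<close> carry these two estimates.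

  The second argument breaks down at an infinite rate, because then \<open>f_m\<close> for
  a proper divisor \<open>m\<close> of \<open>n\<close> may already exceed every exponential in \<open>n\<close>. This gives the example: any
  sequence of the form \<open>n * c n\<close> is the \<open>f*\<close> of some map (a disjoint union of cycles, lemma
  \<open>ex_map_with_cycle_counts\<close>), and \<open>c n = 2 ^ n\<^sup>2\<close> is taken unless \<open>n\<close> is twice an odd
  number. For \<open>n = 2 * m\<close> with \<open>m\<close> odd, the points of least period \<open>m\<close> already make
  \<open>f_n\<close> superexponential, so \<open>c n\<close> is free there, and it is chosen as
  \<open>2 ^ (j * n)\<close> with each \<open>j\<close> occurring infinitely often. Then all the numbers \<open>j * ln 2\<close> are
  limit points.
\<close>

section \<open>Least periods\<close>

text \<open>The definition of a least period through the cardinality of the orbit agrees with the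
  usual one: up to the first return time the orbit does not repeat itself, and afterwards it
  brings nothing new.\<close>

lemma card_orbit_eq_first_return:
  assumes d: "d \<ge> 1" "(T ^^ d) x = x"
    and least: "\<And>k. 1 \<le> k \<Longrightarrow> k < d \<Longrightarrow> (T ^^ k) x \<noteq> x"
  shows "card {(T ^^ k) x | k. True} = d"
proof -
  have orbit: "{(T ^^ k) x | k. True} = (\<lambda>k. (T ^^ k) x) ` {..<d}"
  proof (intro equalityI subsetI)
    fix y assume "y \<in> {(T ^^ k) x | k. True}"
    then obtain k where "y = (T ^^ k) x" by blast
    then have "y = (T ^^ (k mod d)) x" using funpow_mod_eq[OF d(2)] by simp
    moreover have "k mod d < d" using d(1) by simp
    ultimately show "y \<in> (\<lambda>k. (T ^^ k) x) ` {..<d}" by blast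
  qed blast
  have no_repeat: False if ij: "i < j" "j < d" "(T ^^ i) x = (T ^^ j) x" for i j
  proof -
    \<comment> \<open>Pushing both sides forward by \<open>d - j\<close> turns a repetition into an early return.\<close>
    have "(T ^^ (d - j + i)) x = (T ^^ (d - j + j)) x"
      using ij(3) by (simp only: funpow_add o_apply)
    then have "(T ^^ (d - j + i)) x = x" using ij d(2) by simp
    with least[of "d - j + i"] ij show False by simp
  qed
  have "inj_on (\<lambda>k. (T ^^ k) x) {..<d}"
    by (rule inj_onI) (metis no_repeat lessThan_iff linorder_neqE_nat)
  then show ?thesis unfolding orbit by (simp add: card_image)
qed

lemma period_points_imp_least_period:
  assumes n: "n \<ge> 1" and x: "x \<in> period_points X T n"
  shows "\<exists>d\<ge>1. d dvd n \<and> x \<in> least_period_points X T d"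
proof -
  define d where "d = (LEAST d. d \<ge> 1 \<and> (T ^^ d) x = x)"
  have "n \<ge> 1 \<and> (T ^^ n) x = x" using n x by (simp add: period_points_def)
  then have d: "d \<ge> 1 \<and> (T ^^ d) x = x"
    unfolding d_def by (rule LeastI)
  have least: "(T ^^ k) x \<noteq> x" if "1 \<le> k" "k < d" for k
    using not_less_Least[OF that(2)[unfolded d_def]] that(1) by blast
  have "(T ^^ (n mod d)) x = x"
    using funpow_mod_eq[of d T x n] d x by (simp add: period_points_def)
  then have "n mod d = 0"
    using least[of "n mod d"] d by (cases "n mod d = 0") auto
  moreover have "x \<in> least_period_points X T d"
    using card_orbit_eq_first_return[of d T x] d least x
    by (simp add: least_period_points_def period_points_def)
  ultimately show ?thesis using d by auto
qed

lemma least_period_points_subset: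
  assumes "d dvd n"
  shows "least_period_points X T d \<subseteq> period_points X T n"
proof
  fix x assume x: "x \<in> least_period_points X T d"
  then have "(T ^^ (n mod d)) x = (T ^^ n) x"
    by (intro funpow_mod_eq) (simp add: least_period_points_def)
  with assms x show "x \<in> period_points X T n"
    by (simp add: least_period_points_def period_points_def)
qed

lemma period_points_eq_Union_least:
  assumes "n \<ge> 1"
  shows "period_points X T n = (\<Union>d\<in>{d. 1 \<le> d \<and> d dvd n}. least_period_points X T d)"
  using period_points_imp_least_period[OF assms, of _ X T] least_period_points_subset
  by fastforce

lemma finite_positive_divisors: "n \<ge> 1 \<Longrightarrow> finite {d::nat. 1 \<le> d \<and> d dvd n}"
  by (rule finite_subset[of _ "{..n}"]) (auto dest: dvd_imp_le)

lemma num_least_period_le_num_period: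
  assumes "finite_period_map X T" "n \<ge> 1" "d dvd n"
  shows "num_least_period X T d \<le> num_period X T n"
  unfolding num_least_period_def num_period_def
  using assms by (intro card_mono least_period_points_subset) (auto simp: finite_period_map_def)

lemma num_period_le_sum_divisors:
  assumes "n \<ge> 1"
  shows "num_period X T n \<le> (\<Sum>d\<in>{d. 1 \<le> d \<and> d dvd n}. num_least_period X T d)"
  unfolding num_period_def num_least_period_def period_points_eq_Union_least[OF assms]
  by (rule card_UN_le[OF finite_positive_divisors[OF assms]])

lemma num_period_le_sum:
  assumes "n \<ge> 1"
  shows "num_period X T n \<le> (\<Sum>d\<in>{1..n}. num_least_period X T d)"
  using num_period_le_sum_divisors[OF assms, of X T] assms
  by (elim order_trans, intro sum_mono2) (auto dest: dvd_imp_le)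

text \<open>The range of summation can be cut at \<open>n div 2\<close> because no proper divisor of \<open>n\<close> exceeds
  it.\<close>

lemma num_period_le_num_least_period_plus_sum:
  assumes T: "finite_period_map X T" and n: "n \<ge> 1"
  shows "num_period X T n \<le> num_least_period X T n + (\<Sum>d\<in>{1..n div 2}. num_period X T d)"
proof -
  let ?D = "{d. 1 \<le> d \<and> d dvd n}"
  have proper: "?D - {n} \<subseteq> {1..n div 2}"
  proof
    fix d assume "d \<in> ?D - {n}"
    then obtain k where k: "n = d * k" "1 \<le> d" "d \<noteq> n" by (auto elim: dvdE)
    with n have "k \<ge> 2" by (cases k rule: nat.exhaust; cases "k = 1") auto
    then have "d * 2 \<le> n" unfolding k(1) by (rule mult_left_mono) simp
    with k(2) show "d \<in> {1..n div 2}" by auto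
  qed
  have "num_period X T n \<le> (\<Sum>d\<in>?D. num_least_period X T d)"
    by (rule num_period_le_sum_divisors[OF n])
  also have "\<dots> = num_least_period X T n + (\<Sum>d\<in>?D - {n}. num_least_period X T d)"
    using n by (intro sum.remove finite_positive_divisors) auto
  also have "(\<Sum>d\<in>?D - {n}. num_least_period X T d) \<le> (\<Sum>d\<in>{1..n div 2}. num_least_period X T d)"
    using proper by (intro sum_mono2) auto
  also have "\<dots> \<le> (\<Sum>d\<in>{1..n div 2}. num_period X T d)"
    by (intro sum_mono num_least_period_le_num_period[OF T]) auto
  finally show ?thesis by simp
qed

section \<open>Exponential growth rates\<close>

lemma growth_ge_iff:
  assumes "n \<ge> 1"
  shows "ereal c \<le> growth a n \<longleftrightarrow> exp (c * real n) \<le> real (a n)"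
proof (cases "a n = 0")
  case True
  then show ?thesis using assms by (simp add: growth_def log_ext_def)
next
  case False
  then have "exp (c * real n) \<le> real (a n) \<longleftrightarrow> c * real n \<le> ln (real (a n))"
    by (simp add: ln_ge_iff)
  with False assms show ?thesis by (simp add: growth_def log_ext_def field_simps)
qed

lemma growth_le_iff:
  assumes "n \<ge> 1"
  shows "growth a n \<le> ereal c \<longleftrightarrow> real (a n) \<le> exp (c * real n)"
proof (cases "a n = 0")
  case True
  then show ?thesis using assms by (simp add: growth_def log_ext_def)
next
  case False
  then have "real (a n) \<le> exp (c * real n) \<longleftrightarrow> ln (real (a n)) \<le> c * real n"
    by (metis exp_gt_zero ln_exp ln_le_cancel_iff of_nat_0_less_iff neq0_conv)
  with False assms show ?thesis by (simp add: growth_def log_ext_def field_simps)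
qed

lemma growth_tendsto_real_iff:
  "growth a \<longlonglongrightarrow> ereal C \<longleftrightarrow>
     (\<forall>e>0. \<forall>\<^sub>F n in sequentially.
        exp ((C - e) * real n) \<le> real (a n) \<and> real (a n) \<le> exp ((C + e) * real n))"
  (is "?L \<longleftrightarrow> ?R")
proof
  assume L: ?L
  show ?R
  proof (intro allI impI)
    fix e :: real assume e: "e > 0"
    have "\<forall>\<^sub>F n in sequentially. ereal (C - e) < growth a n"
      "\<forall>\<^sub>F n in sequentially. growth a n < ereal (C + e)"
      using L e by (auto intro: order_tendstoD)
    with eventually_ge_at_top[of 1]
    show "\<forall>\<^sub>F n in sequentially.
        exp ((C - e) * real n) \<le> real (a n) \<and> real (a n) \<le> exp ((C + e) * real n)"
      by eventually_elim (use growth_ge_iff growth_le_iff less_imp_le in blast)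
  qed
next
  assume R: ?R
  show ?L
  proof (rule order_tendstoI)
    fix u assume "u < ereal C"
    then obtain r where r: "u < ereal r" "r < C"
      using ereal_dense2 by (metis less_ereal.simps(1))
    have "C - (C - r) = r" by simp
    with R[rule_format, of "C - r"] r(2)
    have "\<forall>\<^sub>F n in sequentially. exp (r * real n) \<le> real (a n)"
      by (auto elim: eventually_mono)
    with eventually_ge_at_top[of 1]
    show "\<forall>\<^sub>F n in sequentially. u < growth a n"
      by eventually_elim (metis growth_ge_iff r(1) order_less_le_trans)
  next
    fix u assume "ereal C < u"
    then obtain r where r: "ereal r < u" "C < r"
      using ereal_dense2 by (metis less_ereal.simps(1))
    have "C + (r - C) = r" by simp
    with R[rule_format, of "r - C"] r(2)
    have "\<forall>\<^sub>F n in sequentially. real (a n) \<le> exp (r * real n)"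
      by (auto elim: eventually_mono)
    with eventually_ge_at_top[of 1]
    show "\<forall>\<^sub>F n in sequentially. growth a n < u"
      by eventually_elim (metis growth_le_iff r(1) order_le_less_trans)
  qed
qed

lemma growth_tendsto_infinity_iff:
  "growth a \<longlonglongrightarrow> \<infinity> \<longleftrightarrow>
     (\<forall>M. \<forall>\<^sub>F n in sequentially. exp (M * real n) \<le> real (a n))"
  (is "?L \<longleftrightarrow> ?R")
proof
  assume L: ?L
  show ?R
  proof
    fix M :: real
    from L have "\<forall>\<^sub>F n in sequentially. ereal M < growth a n"
      by (simp add: tendsto_PInfty)
    with eventually_ge_at_top[of 1]
    show "\<forall>\<^sub>F n in sequentially. exp (M * real n) \<le> real (a n)"
      by eventually_elim (use growth_ge_iff less_imp_le in blast)
  qed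
next
  assume R: ?R
  show ?L unfolding tendsto_PInfty
  proof
    fix r :: real
    from R have "\<forall>\<^sub>F n in sequentially. exp ((r + 1) * real n) \<le> real (a n)" by blast
    with eventually_ge_at_top[of 1]
    show "\<forall>\<^sub>F n in sequentially. ereal r < growth a n"
    proof eventually_elim
      case (elim n)
      then have "ereal (r + 1) \<le> growth a n" by (simp add: growth_ge_iff)
      then show ?case by (rule order_less_le_trans[rotated]) simp
    qed
  qed
qed

lemma eventually_linear_le_exp:
  fixes K \<delta> :: real
  assumes "\<delta> > 0"
  shows "\<forall>\<^sub>F n in sequentially. 1 + real n * K \<le> exp (\<delta> * real n)"
proof -
  obtain N :: nat where N: "real N \<ge> 2 * \<bar>K\<bar> / \<delta>\<^sup>2"
    using real_arch_simple by blast
  show ?thesis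
    using eventually_ge_at_top[of N]
  proof eventually_elim
    case (elim n)
    have "2 * \<bar>K\<bar> / \<delta>\<^sup>2 \<le> real n" using N elim by simp
    then have "K * 2 \<le> real n * \<delta>\<^sup>2" using assms by (simp add: field_simps)
    then have "real n * K * 2 \<le> real n * (real n * \<delta>\<^sup>2)"
      by (metis mult.assoc mult_left_mono of_nat_0_le_iff)
    then have "real n * K * 2 \<le> (\<delta> * real n)\<^sup>2"
      by (simp add: power2_eq_square algebra_simps)
    moreover have "0 \<le> \<delta> * real n" using assms by simp
    ultimately have "1 + real n * K \<le> 1 + \<delta> * real n + (\<delta> * real n)\<^sup>2 / 2"
      by linarith
    also have "\<dots> \<le> exp (\<delta> * real n)"
      using assms by (intro exp_lower_Taylor_quadratic) simp
    finally show ?case .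
  qed
qed

text \<open>An eventual bound becomes a bound for all indices at the price of a constant factor;
  the finitely many exceptions are absorbed into it.\<close>

lemma sum_le_exp_of_eventually_le_exp:
  fixes a :: "nat \<Rightarrow> nat"
  assumes ev: "\<forall>\<^sub>F n in sequentially. real (a n) \<le> exp (B * real n)" and B: "B \<ge> 0"
  obtains K where "K \<ge> 0"
    "\<And>m n. m \<le> n \<Longrightarrow> (\<Sum>d\<in>{1..m}. real (a d)) \<le> real n * K * exp (B * real m)"
proof -
  from ev obtain N where N: "\<And>n. n \<ge> N \<Longrightarrow> real (a n) \<le> exp (B * real n)"
    by (auto simp: eventually_sequentially)
  define K where "K = 1 + (\<Sum>d<N. real (a d))"
  have K: "K \<ge> 1" unfolding K_def by (simp add: sum_nonneg)
  have bound: "real (a d) \<le> K * exp (B * real d)" for d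
  proof (cases "d < N")
    case True
    then have "real (a d) \<le> (\<Sum>d<N. real (a d))"
      by (intro member_le_sum) auto
    also have "\<dots> \<le> K * 1" by (simp add: K_def)
    also have "\<dots> \<le> K * exp (B * real d)" using B K by (intro mult_left_mono) auto
    finally show ?thesis .
  next
    case False
    then have "real (a d) \<le> 1 * exp (B * real d)" using N by simp
    also have "\<dots> \<le> K * exp (B * real d)" using K by (intro mult_right_mono) auto
    finally show ?thesis .
  qed
  show ?thesis
  proof (rule that[of K])
    show "K \<ge> 0" using K by simp
    fix m n :: nat assume mn: "m \<le> n"
    have "(\<Sum>d\<in>{1..m}. real (a d)) \<le> (\<Sum>d\<in>{1..m}. K * exp (B * real m))"
    proof (rule sum_mono)
      fix d assume "d \<in> {1..m}"
      then have "K * exp (B * real d) \<le> K * exp (B * real m)"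
        using B K by (intro mult_left_mono) (auto intro: mult_left_mono)
      with bound[of d] show "real (a d) \<le> K * exp (B * real m)" by linarith
    qed
    also have "\<dots> = real m * (K * exp (B * real m))" by simp
    also have "\<dots> \<le> real n * (K * exp (B * real m))"
      using mn K by (intro mult_right_mono) auto
    finally show "(\<Sum>d\<in>{1..m}. real (a d)) \<le> real n * K * exp (B * real m)"
      by (simp add: mult.assoc)
  qed
qed

text \<open>Summation over \<open>{1..n}\<close> costs at most a linear factor, which is invisible to a growth rate.
  The rate must not be negative: otherwise the first terms would dominate the sum.\<close>

lemma growth_tendsto_of_le_sum:
  fixes a b :: "nat \<Rightarrow> nat"
  assumes le: "\<And>n. n \<ge> 1 \<Longrightarrow> a n \<le> b n"
    and upper: "\<And>n. n \<ge> 1 \<Longrightarrow> b n \<le> (\<Sum>d\<in>{1..n}. a d)"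
    and C: "0 \<le> C" and lim: "growth a \<longlonglongrightarrow> C"
  shows "growth b \<longlonglongrightarrow> C"
proof (cases C)
  case (real c)
  have c: "c \<ge> 0" using C real by simp
  have "growth b \<longlonglongrightarrow> ereal c"
    unfolding growth_tendsto_real_iff
  proof (intro allI impI)
    fix e :: real assume e: "e > 0"
    have ev: "\<forall>\<^sub>F n in sequentially.
        exp ((c - e / 2) * real n) \<le> real (a n) \<and> real (a n) \<le> exp ((c + e / 2) * real n)"
      using lim[unfolded real growth_tendsto_real_iff] e by simp
    obtain K where K: "K \<ge> 0" "\<And>m n. m \<le> n \<Longrightarrow>
        (\<Sum>d\<in>{1..m}. real (a d)) \<le> real n * K * exp ((c + e / 2) * real m)"
      by (rule sum_le_exp_of_eventually_le_exp[of a "c + e / 2"])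
        (use ev c e in \<open>auto elim: eventually_mono\<close>)
    have "\<forall>\<^sub>F n in sequentially. 1 + real n * K \<le> exp (e / 2 * real n)"
      using e by (intro eventually_linear_le_exp) simp
    with ev eventually_ge_at_top[of 1]
    show "\<forall>\<^sub>F n in sequentially.
        exp ((c - e) * real n) \<le> real (b n) \<and> real (b n) \<le> exp ((c + e) * real n)"
    proof eventually_elim
      case (elim n)
      have "exp ((c - e) * real n) \<le> exp ((c - e / 2) * real n)"
        using e by (simp add: mult_right_mono)
      also have "\<dots> \<le> real (a n)" using elim by blast
      also have "\<dots> \<le> real (b n)" using le elim by simp
      finally have lower: "exp ((c - e) * real n) \<le> real (b n)" .
      have "real (b n) \<le> (\<Sum>d\<in>{1..n}. real (a d))"
        using upper[of n] elim by (metis of_nat_le_iff of_nat_sum)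
      also have "\<dots> \<le> (real n * K) * exp ((c + e / 2) * real n)" by (rule K(2)) simp
      also have "\<dots> \<le> exp (e / 2 * real n) * exp ((c + e / 2) * real n)"
        using elim by (intro mult_right_mono) auto
      also have "\<dots> = exp ((c + e) * real n)"
        by (simp flip: exp_add add: algebra_simps)
      finally show ?case using lower by blast
    qed
  qed
  then show ?thesis by (simp add: real)
next
  case PInf
  have "\<forall>\<^sub>F n in sequentially. exp (M * real n) \<le> real (b n)" for M
  proof -
    have "\<forall>\<^sub>F n in sequentially. exp (M * real n) \<le> real (a n)"
      using lim[unfolded PInf growth_tendsto_infinity_iff] by blast
    with eventually_ge_at_top[of 1] show ?thesis
      by eventually_elim (meson le of_nat_le_iff order_trans)
  qed
  then show ?thesis unfolding PInf growth_tendsto_infinity_iff by blast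
next
  case MInf
  with C show ?thesis by simp
qed

text \<open>The sum up to \<open>n div 2\<close> grows at only half the rate of \<open>b\<close>, so that at a positive
  finite rate its removal changes nothing.\<close>

lemma growth_tendsto_of_ge_minus_sum:
  fixes a b :: "nat \<Rightarrow> nat"
  assumes le: "\<And>n. n \<ge> 1 \<Longrightarrow> a n \<le> b n"
    and lower: "\<And>n. n \<ge> 1 \<Longrightarrow> b n \<le> a n + (\<Sum>d\<in>{1..n div 2}. b d)"
    and C: "0 < C" and lim: "growth b \<longlonglongrightarrow> ereal C"
  shows "growth a \<longlonglongrightarrow> ereal C"
  unfolding growth_tendsto_real_iff
proof (intro allI impI)
  fix \<epsilon> :: real assume \<epsilon>: "\<epsilon> > 0"
  \<comment> \<open>The bound \<open>C / 4\<close> ensures \<open>(C + e) / 2 \<le> C - e\<close>: the removed sum stays below the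
    target lower bound.\<close>
  define e where "e = min \<epsilon> (C / 4)"
  have e: "e > 0" "e \<le> \<epsilon>" "4 * e \<le> C" using \<epsilon> C by (auto simp: e_def)
  have ev: "\<forall>\<^sub>F n in sequentially.
      exp ((C - e / 2) * real n) \<le> real (b n) \<and> real (b n) \<le> exp ((C + e / 2) * real n)"
    using lim[unfolded growth_tendsto_real_iff] e by simp
  have "\<forall>\<^sub>F n in sequentially. real (b n) \<le> exp ((C + e) * real n)"
    using lim[unfolded growth_tendsto_real_iff] e(1) by (auto elim: eventually_mono)
  then obtain K where K: "K \<ge> 0" "\<And>m n. m \<le> n \<Longrightarrow>
      (\<Sum>d\<in>{1..m}. real (b d)) \<le> real n * K * exp ((C + e) * real m)"
    by (rule sum_le_exp_of_eventually_le_exp) (use C e in auto)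
  have "\<forall>\<^sub>F n in sequentially. 1 + real n * K \<le> exp (e / 2 * real n)"
    using e by (intro eventually_linear_le_exp) simp
  with ev eventually_ge_at_top[of 1]
  show "\<forall>\<^sub>F n in sequentially.
      exp ((C - \<epsilon>) * real n) \<le> real (a n) \<and> real (a n) \<le> exp ((C + \<epsilon>) * real n)"
  proof eventually_elim
    case (elim n)
    have "real (a n) \<le> real (b n)" using le elim by simp
    also have "\<dots> \<le> exp ((C + e / 2) * real n)" using elim by blast
    also have "\<dots> \<le> exp ((C + \<epsilon>) * real n)" using e by (simp add: mult_right_mono)
    finally have upper: "real (a n) \<le> exp ((C + \<epsilon>) * real n)" .
    have "(C + e) * real (n div 2) \<le> (C + e) * (real n / 2)"
      using C e by (intro mult_left_mono) auto
    also have "\<dots> = ((C + e) / 2) * real n" by simp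
    also have "\<dots> \<le> (C - e) * real n" using e by (intro mult_right_mono) auto
    finally have half: "(C + e) * real (n div 2) \<le> (C - e) * real n" .
    have "(\<Sum>d\<in>{1..n div 2}. real (b d)) \<le> real n * K * exp ((C + e) * real (n div 2))"
      by (rule K(2)) simp
    also have "\<dots> \<le> real n * K * exp ((C - e) * real n)"
      using half K(1) by (intro mult_left_mono) auto
    finally have rest: "(\<Sum>d\<in>{1..n div 2}. real (b d)) \<le> real n * K * exp ((C - e) * real n)" .
    have "(1 + real n * K) * exp ((C - e) * real n)
        \<le> exp (e / 2 * real n) * exp ((C - e) * real n)"
      using elim by (intro mult_right_mono) auto
    also have "\<dots> = exp ((C - e / 2) * real n)"
      by (simp flip: exp_add add: algebra_simps)
    also have "\<dots> \<le> real (b n)" using elim by blast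
    also have "\<dots> \<le> real (a n) + (\<Sum>d\<in>{1..n div 2}. real (b d))"
      using lower[of n] elim by (metis of_nat_add of_nat_le_iff of_nat_sum)
    finally have "exp ((C - e) * real n) \<le> real (a n)"
      using rest by (simp add: algebra_simps)
    moreover have "exp ((C - \<epsilon>) * real n) \<le> exp ((C - e) * real n)"
      using e by (simp add: mult_right_mono)
    ultimately show ?case using upper by linarith
  qed
qed

section \<open>Maps with prescribed numbers of cycles\<close>

text \<open>Rotates the last component. On \<open>(n, i, k)\<close> with \<open>k < n\<close>, it is the \<open>i\<close>-th of the
  cycles of length \<open>n\<close>.\<close>

definition rotate_cycle :: "nat \<times> nat \<times> nat \<Rightarrow> nat \<times> nat \<times> nat" where
  "rotate_cycle = (\<lambda>(n, i, k). (n, i, Suc k mod n))"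

lemma rotate_cycle_funpow:
  assumes "k < n"
  shows "(rotate_cycle ^^ m) (n, i, k) = (n, i, (k + m) mod n)"
  using assms by (induction m) (simp_all add: rotate_cycle_def mod_Suc_eq)

lemma rotate_cycle_fixed_iff:
  assumes "k < n"
  shows "(rotate_cycle ^^ m) (n, i, k) = (n, i, k) \<longleftrightarrow> n dvd m"
proof -
  have "(k + m) mod n = k \<longleftrightarrow> n dvd m"
    using mod_eq_dvd_iff_nat[of k "k + m" n] assms by simp
  then show ?thesis using assms by (simp add: rotate_cycle_funpow)
qed

text \<open>The disjoint union of the cycles is coded into the natural numbers. Since \<open>to_nat\<close>
  conjugates the rotation with the coded map, all periods are preserved.\<close>

lemma ex_map_with_cycle_counts:
  fixes c :: "nat \<Rightarrow> nat"
  shows "\<exists>(X :: nat set) T. finite_period_map X T \<and>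
           (\<forall>n\<ge>1. num_least_period X T n = n * c n)"
proof -
  define Y where "Y = {(n, i, k) | n i k. i < c n \<and> k < n}"
  define X where "X = (to_nat :: nat \<times> nat \<times> nat \<Rightarrow> nat) ` Y"
  define T where "T = (\<lambda>x. to_nat (rotate_cycle (from_nat x)))"
  have T_funpow: "(T ^^ m) (to_nat y) = to_nat ((rotate_cycle ^^ m) y)" for m y
    by (induction m) (simp_all add: T_def)
  have "rotate_cycle y \<in> Y" if "y \<in> Y" for y
    using that by (auto simp: Y_def rotate_cycle_def)
  then have T_X: "T \<in> X \<rightarrow> X" by (auto simp: X_def T_def)
  have card_orbit: "card {(T ^^ m) (to_nat (n, i, k)) | m. True} = n" if "k < n" for n i k :: nat
    using that
    by (intro card_orbit_eq_first_return)
      (auto simp: T_funpow rotate_cycle_fixed_iff dest: dvd_imp_le)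
  have least: "least_period_points X T n = to_nat ` ({n} \<times> {..<c n} \<times> {..<n})" for n
    using card_orbit
    by (auto simp: least_period_points_def X_def Y_def T_funpow rotate_cycle_fixed_iff)
  have "num_least_period X T n = n * c n" for n
    unfolding num_least_period_def least
    by (subst card_image) (auto intro: inj_on_subset[OF inj_to_nat] simp: card_cartesian_product)
  moreover have "finite (period_points X T n)" if "n \<ge> 1" for n
    unfolding period_points_eq_Union_least[OF that]
    using finite_positive_divisors[OF that] by (auto simp: least)
  ultimately show ?thesis using T_X by (auto simp: finite_period_map_def)
qed

section \<open>Superexponential growth with many limit points\<close>

text \<open>The condition \<open>n mod 4 = 2\<close> says that \<open>n\<close> is twice an odd number. There the first
  component of the decoded pair \<open>n div 4\<close> selects the growth
  rate; every rate is selected infinitely often because the second component is free.\<close>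

definition mixed_cycle_count :: "nat \<Rightarrow> nat" where
  "mixed_cycle_count n =
     (if n mod 4 = 2 then 2 ^ (fst (prod_decode (n div 4)) * n) else 2 ^ (n\<^sup>2))"

lemma two_power_eq_exp: "2 ^ n = exp (ln 2 * real n)"
  by (metis exp_ln exp_of_nat2_mult mult.commute zero_less_numeral)

lemma mixed_count_ge_exp_square:
  assumes "n \<ge> 1" "n mod 4 \<noteq> 2"
  shows "exp (ln 2 * real n * real n) \<le> real (n * mixed_cycle_count n)"
proof -
  have "exp (ln 2 * real n * real n) = real (1 * 2 ^ (n\<^sup>2))"
    by (simp add: two_power_eq_exp power2_eq_square mult.assoc)
  also have "\<dots> \<le> real (n * 2 ^ (n\<^sup>2))"
    using assms(1) unfolding of_nat_le_iff by (intro mult_right_mono) auto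
  finally show ?thesis using assms(2) by (simp add: mixed_cycle_count_def)
qed

lemma strict_mono_prod_encode_right: "strict_mono (\<lambda>k. prod_encode (j, k))"
  by (rule strict_monoI_Suc) (simp add: prod_encode_def)

text \<open>Along the indices that select the rate \<open>j\<close>, the factor \<open>n\<close> in \<open>n * 2 ^ (j * n)\<close> (each cycle
  of length \<open>n\<close> has \<open>n\<close> points) disappears in the limit.\<close>

lemma limit_point_of_mixed_count:
  fixes a :: "nat \<Rightarrow> nat"
  assumes a: "\<And>n. n \<ge> 1 \<Longrightarrow> a n = n * mixed_cycle_count n"
  shows "real j * ln 2 \<in> limit_points (growth a)"
proof -
  define r where "r = (\<lambda>k. 4 * prod_encode (j, k) + 2)"
  have r_mono: "strict_mono r"
    using strict_mono_prod_encode_right[of j] by (simp add: r_def strict_mono_def)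
  have growth_r: "growth a (r k) = ereal (ln (real (r k)) / real (r k) + real j * ln 2)" for k
  proof -
    have "r k mod 4 = 2" "r k div 4 = prod_encode (j, k)" and pos: "r k \<ge> 1"
      unfolding r_def by presburger+
    then have a_r: "a (r k) = r k * 2 ^ (j * r k)"
      by (simp add: a mixed_cycle_count_def)
    have "ln (real (a (r k))) = ln (real (r k)) + real j * real (r k) * ln 2"
      using pos unfolding a_r by (simp add: ln_mult ln_realpow)
    moreover have "a (r k) \<noteq> 0" using pos a_r by simp
    ultimately show ?thesis
      using pos by (simp add: growth_def log_ext_def field_simps)
  qed
  have "(\<lambda>k. ln (real (r k)) / real (r k)) \<longlonglongrightarrow> 0"
    using LIMSEQ_subseq_LIMSEQ[OF lim_ln_over_n r_mono] by (simp add: o_def)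
  then have "(\<lambda>k. ln (real (r k)) / real (r k) + real j * ln 2) \<longlonglongrightarrow> 0 + real j * ln 2"
    by (intro tendsto_intros)
  then have "(\<lambda>k. growth a (r k)) \<longlonglongrightarrow> ereal (real j * ln 2)"
    unfolding growth_r by simp
  moreover have "\<forall>k. r k \<ge> 1" by (simp add: r_def)
  ultimately show ?thesis using r_mono unfolding limit_points_def by blast
qed

lemma infinite_limit_points_of_mixed_count:
  assumes "\<And>n. n \<ge> 1 \<Longrightarrow> a n = n * mixed_cycle_count n"
  shows "infinite (limit_points (growth a))"
proof -
  have "inj (\<lambda>j::nat. real j * ln 2)" by (rule injI) simp
  then have "infinite (range (\<lambda>j::nat. real j * ln 2))" by (rule range_inj_infinite)
  moreover have "range (\<lambda>j::nat. real j * ln 2) \<subseteq> limit_points (growth a)"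
    using limit_point_of_mixed_count[OF assms] by blast
  ultimately show ?thesis by (rule infinite_super[rotated])
qed

lemma unbounded_mixed_count:
  assumes a: "\<And>n. n \<ge> 1 \<Longrightarrow> a n = n * mixed_cycle_count n"
  shows "unbounded_seq (growth a)"
  unfolding unbounded_seq_def
proof
  fix M :: real
  obtain k :: nat where k: "M / ln 2 < real k" using reals_Archimedean2 by blast
  define n where "n = 4 * k + 1"
  have n: "n \<ge> 1" "n mod 4 \<noteq> 2" by (simp_all add: n_def)
  have "exp (ln 2 * real n * real n) \<le> real (a n)"
    using mixed_count_ge_exp_square[OF n] n by (simp add: a)
  then have "ereal (ln 2 * real n) \<le> growth a n" using growth_ge_iff[OF n(1)] by blast
  moreover have "M / ln 2 < real n" using k by (simp add: n_def)
  then have "M < ln 2 * real n" by (simp add: field_simps)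
  ultimately have "growth a n > ereal M"
    by (meson less_ereal.simps(1) order_less_le_trans)
  with n show "\<exists>n\<ge>1. growth a n > ereal M" by blast
qed

text \<open>Either \<open>n\<close> itself or \<open>n div 2\<close>, when this is odd, is a divisor at which the count of
  points of that least period is superexponential. In both cases the divisor is at least \<open>n / 2\<close>,
  whence the exponent \<open>n\<^sup>2 / 4\<close>.\<close>

lemma growth_num_period_tendsto_infinity:
  assumes T: "finite_period_map X T"
    and a: "\<And>n. n \<ge> 1 \<Longrightarrow> num_least_period X T n = n * mixed_cycle_count n"
  shows "growth (num_period X T) \<longlonglongrightarrow> \<infinity>"
  unfolding growth_tendsto_infinity_iff
proof
  fix M :: real
  obtain N :: nat where N: "4 * M / ln 2 \<le> real N" using real_arch_simple by blast
  show "\<forall>\<^sub>F n in sequentially. exp (M * real n) \<le> real (num_period X T n)"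
    using eventually_ge_at_top[of N] eventually_ge_at_top[of 1]
  proof eventually_elim
    case (elim n)
    obtain d where d: "d dvd n" "d \<ge> 1" "d mod 4 \<noteq> 2" "n \<le> 2 * d"
    proof (cases "n mod 4 = 2")
      case True
      then have "n = 2 * (n div 2)" "n div 2 mod 4 \<noteq> 2" "n div 2 \<ge> 1" by presburger+
      then show ?thesis by (intro that[of "n div 2"]) (auto intro: dvdI[of _ _ 2])
    next
      case False
      then show ?thesis using elim by (intro that[of n]) auto
    qed
    have "4 * M / ln 2 \<le> real n" using N elim by linarith
    then have "M \<le> ln 2 * (real n / 2) * (1 / 2)" by (simp add: field_simps)
    then have "M * real n \<le> ln 2 * (real n / 2) * (1 / 2) * real n"
      by (intro mult_right_mono) auto
    also have "\<dots> = ln 2 * ((real n / 2) * (real n / 2))" by simp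
    also have "\<dots> \<le> ln 2 * (real d * real d)"
      using d(4) by (intro mult_left_mono mult_mono) auto
    finally have "exp (M * real n) \<le> exp (ln 2 * real d * real d)"
      by (simp add: mult.assoc)
    also have "\<dots> \<le> real (num_least_period X T d)"
      using mixed_count_ge_exp_square[OF d(2,3)] a[OF d(2)] by simp
    also have "\<dots> \<le> real (num_period X T n)"
      using num_least_period_le_num_period[OF T elim(2) d(1)] by simp
    finally show ?case .
  qed
qed

section \<open>Growth of the two counting functions\<close>

theorem theorem4p2:
  shows
    "(\<forall>(X :: 'a set) T. finite_period_map X T \<longrightarrow>
        (\<forall>C::ereal. 0 \<le> C \<longrightarrow>
           growth (num_least_period X T) \<longlonglongrightarrow> C \<longrightarrow>
           growth (num_period X T) \<longlonglongrightarrow> C) \<and>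
        (\<forall>C::ereal. 0 < C \<and> C < \<infinity> \<longrightarrow>
           (growth (num_least_period X T) \<longlonglongrightarrow> C \<longleftrightarrow>
            growth (num_period X T) \<longlonglongrightarrow> C))) \<and>
     (\<exists>(X :: nat set) T. finite_period_map X T \<and>
        growth (num_period X T) \<longlonglongrightarrow> \<infinity> \<and>
        unbounded_seq (growth (num_least_period X T)) \<and>
        infinite (limit_points (growth (num_least_period X T))))"
proof (rule conjI, intro allI impI)
  fix X :: "'a set" and T
  assume T: "finite_period_map X T"
  have le: "num_least_period X T n \<le> num_period X T n" if "n \<ge> 1" for n
    using num_least_period_le_num_period[OF T that] by simp
  have least_to_all: "growth (num_period X T) \<longlonglongrightarrow> C"
    if "0 \<le> C" "growth (num_least_period X T) \<longlonglongrightarrow> C" for C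
    by (rule growth_tendsto_of_le_sum[OF _ _ that]) (use le num_period_le_sum in auto)
  have all_to_least: "growth (num_least_period X T) \<longlonglongrightarrow> C"
    if C: "0 < C" "C < \<infinity>" and lim: "growth (num_period X T) \<longlonglongrightarrow> C" for C
  proof -
    obtain c where c: "C = ereal c" "0 < c" using C by (cases C) auto
    show ?thesis
      unfolding c(1)
      by (rule growth_tendsto_of_ge_minus_sum[where b = "num_period X T"])
        (use le num_period_le_num_least_period_plus_sum[OF T] c lim in auto)
  qed
  show "(\<forall>C. 0 \<le> C \<longrightarrow> growth (num_least_period X T) \<longlonglongrightarrow> C \<longrightarrow>
           growth (num_period X T) \<longlonglongrightarrow> C) \<and>
        (\<forall>C. 0 < C \<and> C < \<infinity> \<longrightarrow>
           (growth (num_least_period X T) \<longlonglongrightarrow> C \<longleftrightarrow> growth (num_period X T) \<longlonglongrightarrow> C))"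
    using least_to_all all_to_least by (meson less_imp_le)
next
  obtain X :: "nat set" and T where T: "finite_period_map X T"
    and count: "\<And>n. n \<ge> 1 \<Longrightarrow> num_least_period X T n = n * mixed_cycle_count n"
    using ex_map_with_cycle_counts[of mixed_cycle_count] by blast
  show "\<exists>(X :: nat set) T. finite_period_map X T \<and>
        growth (num_period X T) \<longlonglongrightarrow> \<infinity> \<and>
        unbounded_seq (growth (num_least_period X T)) \<and>
        infinite (limit_points (growth (num_least_period X T)))"
    using T growth_num_period_tendsto_infinity[OF T count] unbounded_mixed_count[OF count]
      infinite_limit_points_of_mixed_count[OF count] by blast
qed

end
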